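(* For every prime $p\ge 3$, we have $$r_p(\mathbb{F}_p^3)\ge p^3-3p^2+\frac18p^{3/2}-\frac{7}{16}p.$$ As a consequence, $r_p(\mathbb{F}_p^3)\ge (p-1)^3+\frac18p^{3/2}-O(p)$ as the prime $p$ tends to infinity.
   Context: For a prime $p$, $r_p(\mathbb{F}_p^3)$ denotes the largest size of a subset $S\subseteq\mathbb{F}_p^3$ containing no nontrivial $p$-term arithmetic progression, i.e., no full affine line $\{\mathbf{a}+\lambda\mathbf{v}:\lambda\in\mathbb{F}_p\}$ with $\mathbf{a},\mathbf{v}\in\mathbb{F}_p^3$, $\mathbf{v}\neq\mathbf{0}$. *)

theory Defs
  imports Complex_Main "HOL-Computational_Algebra.Primes"
begin

text \<open>F_p^3 is modelled by triples of residues in {0..<p}, arithmetic taken mod p.\<close>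

type_synonym pt = "nat \<times> nat \<times> nat"

definition Fp3 :: "nat \<Rightarrow> pt set" where
  "Fp3 p = {0..<p} \<times> {0..<p} \<times> {0..<p}"

definition affine_line :: "nat \<Rightarrow> pt \<Rightarrow> pt \<Rightarrow> pt set" where
  "affine_line p a v =
     (\<lambda>l. ((fst a + l * fst v) mod p,
            (fst (snd a) + l * fst (snd v)) mod p,
            (snd (snd a) + l * snd (snd v)) mod p)) ` {0..<p}"

definition contains_full_line :: "nat \<Rightarrow> pt set \<Rightarrow> bool" where
  "contains_full_line p S \<longleftrightarrow>
     (\<exists>a\<in>Fp3 p. \<exists>v\<in>Fp3 p. v \<noteq> (0,0,0) \<and> affine_line p a v \<subseteq> S)"

definition r_p3 :: "nat \<Rightarrow> nat" where
  "r_p3 p = Max {card S | S. S \<subseteq> Fp3 p \<and> \<not> contains_full_line p S}"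

end

theory Submission
  imports Defs "HOL-Number_Theory.Number_Theory"
begin

text \<open>
  The complement of the union of the three coordinate planes has $(p-1)^3$ points, so it suffices
  to find a set that meets every line and is smaller than that union. Fix $t$ nonzero heights $z$ and let
  $Q$, $N$ be the nonzero quadratic residues and the nonresidues. Remove from the plane $z=0$ the
  points $(a,b,0)$ with $a$ one of the heights and $b \in Q$, and add the points $(z,b,z)$, $b \in Q$;
  this costs nothing and keeps the vertical lines blocked. The added points on height $z$ meet every
  line through $(x,0,z)$ and $(0,y,z)$ with $y \in N$ and $x(x-z) \in N$, because the second
  coordinate of that line at $z$ is $y(x-z)/x$, a product of two nonresidues up to a square.
  Hence one may remove such points $(x,0,z)$, $x \in X_z$, and equally many points $(0,y,z)$, at the
  price of $|X_z|$ further points that block the axis-parallel lines on that height.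
  The only other lines to look after join a removed $(a,b,0)$ to removed points on both planes
  $x=0$ and $y=0$; they are excluded by forbidding at most $t^2$ values $x$ in each $X_z$.
  So $|X_z| \ge (p-1)/2 - t^2$, and the total saving is at least $t((p-1)/2 - t^2)$;
  take $t$ about $\frac25 \sqrt p$.
\<close>

section \<open>Coordinates along an affine line modulo p\<close>

lemma line_coordinate_hits:
  fixes p a v c :: nat
  assumes "prime p" "v < p" "v \<noteq> 0" "c < p"
  shows "\<exists>l<p. (a + l * v) mod p = c"
proof -
  have "coprime v p"
    using assms by (metis coprime_commute nat_dvd_not_less neq0_conv prime_imp_coprime)
  then obtain k where k: "[v * k = 1] (mod p)"
    using cong_solve_coprime_nat by auto
  \<comment> \<open>\<open>d\<close> represents c - a modulo p without truncated subtraction;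
    \<open>l\<close> is then (c - a)/v.\<close>
  define d where "d = (p - a mod p) + c"
  define l where "l = (k * d) mod p"
  have p0: "p > 0" using assms by auto
  have "[a + l * v = a + k * d * v] (mod p)"
    unfolding l_def by (intro cong_add cong_mult cong_refl) (simp add: cong_def)
  also have "a + k * d * v = a + (v * k) * d" by (simp add: ac_simps)
  also have "[a + (v * k) * d = a mod p + 1 * d] (mod p)"
    by (intro cong_add cong_mult cong_refl k) (simp add: cong_def)
  also have "a mod p + 1 * d = p + c"
    using less_imp_le[OF mod_less_divisor[OF p0, of a]] unfolding d_def by simp
  also have "[p + c = c] (mod p)" by (simp add: cong_def)
  finally have "(a + l * v) mod p = c"
    using assms(4) by (simp add: cong_def)
  moreover have "l < p" using p0 by (simp add: l_def)
  ultimately show ?thesis by blast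
qed

text \<open>Both sides equal (i - k)(j - k)vw modulo p. This eliminates the line parameter and
  leaves a relation between coordinates alone.\<close>

lemma line_coordinates_proportional:
  fixes p a v b w :: nat
  defines "x \<equiv> \<lambda>l. int ((a + l * v) mod p)" and "y \<equiv> \<lambda>l. int ((b + l * w) mod p)"
  shows "[(x i - x k) * (y j - y k) = (x j - x k) * (y i - y k)] (mod int p)"
proof -
  have x: "[x l = int a + int l * int v] (mod int p)" for l
    unfolding x_def by (simp add: cong_def zmod_int)
  have y: "[y l = int b + int l * int w] (mod int p)" for l
    unfolding y_def by (simp add: cong_def zmod_int)
  have "[(x i - x k) * (y j - y k)
      = ((int a + int i * int v) - (int a + int k * int v)) * ((int b + int j * int w) - (int b + int k * int w))] (mod int p)"
    by (intro cong_mult cong_diff x y)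
  also have "((int a + int i * int v) - (int a + int k * int v)) * ((int b + int j * int w) - (int b + int k * int w))
    = ((int a + int j * int v) - (int a + int k * int v)) * ((int b + int i * int w) - (int b + int k * int w))"
    by (simp add: algebra_simps)
  also have "[\<dots> = (x j - x k) * (y i - y k)] (mod int p)"
    by (rule cong_sym, intro cong_mult cong_diff x y)
  finally show ?thesis .
qed

section \<open>The blocking set and the lines it meets\<close>

text \<open>Call the points removed from the coordinate planes holes. \<open>transversal\<close>
  says that (u, 0), (x, z), (0, w) are not collinear; these are holes of the three planes with the
  second coordinate forgotten. In \<open>planar\<close>, b is the second coordinate at first
  coordinate z of the line through (x, 0, z) and (0, y, z).\<close>

locale line_blocker =
  fixes p :: nat and Z Q N :: "nat set" and X Y :: "nat \<Rightarrow> nat set" and f :: "nat \<Rightarrow> nat \<Rightarrow> nat"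
  assumes prime_p: "prime p"
    and Z_sub: "Z \<subseteq> {1..<p}"
    and Q_sub: "Q \<subseteq> {1..<p}"
    and N_sub: "N \<subseteq> {1..<p}"
    and QN: "Q \<inter> N = {}"
    and X_sub: "X z \<subseteq> {1..<p} - Z"
    and Y_sub: "Y z \<subseteq> N"
    and bij: "bij_betw (f z) (X z) (Y z)"
    and transversal: "\<lbrakk>z \<in> Z; w \<in> Z; w \<noteq> z; u \<in> Z; x \<in> X z\<rbrakk>
      \<Longrightarrow> \<not> [int x * int w = int u * (int w - int z)] (mod int p)"
    and planar: "\<lbrakk>z \<in> Z; x \<in> X z; y \<in> N; b < p; [int b * int x = int y * (int x - int z)] (mod int p)\<rbrakk>
      \<Longrightarrow> b \<in> Q"
begin

definition blocker :: "pt set" where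
  "blocker = {(x, y, z). x < p \<and> y < p \<and> z < p \<and>
     (x = 0 \<and> \<not> (z \<in> Z \<and> y \<in> Y z) \<or>
      y = 0 \<and> \<not> (z \<in> Z \<and> x \<in> X z) \<or>
      z = 0 \<and> \<not> (x \<in> Z \<and> y \<in> Q) \<or>
      z \<in> Z \<and> x = z \<and> y \<in> Q \<or>
      z \<in> Z \<and> x \<in> X z \<and> y = f z x)}"

lemma f_in_Y: "x \<in> X z \<Longrightarrow> f z x \<in> Y z"
  using bij by (metis bij_betwE)

lemma pos:
  "z \<in> Z \<Longrightarrow> 0 < z \<and> z < p" "y \<in> Q \<Longrightarrow> 0 < y \<and> y < p" "y \<in> Y z \<Longrightarrow> 0 < y \<and> y < p"
  "x \<in> X z \<Longrightarrow> 0 < x \<and> x < p" "x \<in> X z \<Longrightarrow> x \<notin> Z" "y \<in> Y z \<Longrightarrow> y \<notin> Q"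
  using Z_sub Q_sub N_sub X_sub[of z] Y_sub[of z] QN by fastforce+

text \<open>A line that misses the set can cross a coordinate plane only at a hole. Which direction
  coordinates vanish decides which planes it must cross, and in each case the holes it meets are
  incompatible or lead to an added point.\<close>

lemma blocker_meets_line:
  assumes v: "v1 < p" "v2 < p" "v3 < p" "(v1, v2, v3) \<noteq> (0, 0, 0)"
  shows "\<exists>l<p. ((a1 + l * v1) mod p, (a2 + l * v2) mod p, (a3 + l * v3) mod p) \<in> blocker"
proof (rule ccontr)
  define x where "x l = (a1 + l * v1) mod p" for l
  define y where "y l = (a2 + l * v2) mod p" for l
  define z where "z l = (a3 + l * v3) mod p" for l
  have p0: "p > 0" using prime_p by (simp add: prime_gt_0_nat)
  have lt: "x l < p" "y l < p" "z l < p" for l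
    using p0 by (auto simp: x_def y_def z_def)
  assume "\<not> ?thesis"
  then have miss: "(x l, y l, z l) \<notin> blocker" if "l < p" for l
    using that by (auto simp: x_def y_def z_def)
  have x0: "z l \<in> Z \<and> y l \<in> Y (z l)" if "l < p" "x l = 0" for l
    using miss[OF that(1)] that(2) lt[of l] by (auto simp: blocker_def)
  have y0: "z l \<in> Z \<and> x l \<in> X (z l)" if "l < p" "y l = 0" for l
    using miss[OF that(1)] that(2) lt[of l] by (auto simp: blocker_def)
  have z0: "x l \<in> Z \<and> y l \<in> Q" if "l < p" "z l = 0" for l
    using miss[OF that(1)] that(2) lt[of l] by (auto simp: blocker_def)
  have xz: "y l \<notin> Q" if "l < p" "x l = z l" "z l \<in> Z" for l
    using miss[OF that(1)] that lt[of l] by (auto simp: blocker_def)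
  have xf: "y l \<noteq> f (z l) (x l)" if "l < p" "z l \<in> Z" "x l \<in> X (z l)" for l
    using miss[OF that(1)] that lt[of l] by (auto simp: blocker_def)
  have hx: "\<exists>l<p. x l = c" if "v1 \<noteq> 0" "c < p" for c
    unfolding x_def using line_coordinate_hits[OF prime_p v(1) that] by blast
  have hy: "\<exists>l<p. y l = c" if "v2 \<noteq> 0" "c < p" for c
    unfolding y_def using line_coordinate_hits[OF prime_p v(2) that] by blast
  have hz: "\<exists>l<p. z l = c" if "v3 \<noteq> 0" "c < p" for c
    unfolding z_def using line_coordinate_hits[OF prime_p v(3) that] by blast
  have cx: "x l = x 0" if "v1 = 0" for l using that by (simp add: x_def)
  have cy: "y l = y 0" if "v2 = 0" for l using that by (simp add: y_def)
  have cz: "z l = z 0" if "v3 = 0" for l using that by (simp add: z_def)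
  show False
  proof (cases "v3 = 0")
    case True
    note cz = cz[OF True]
    consider "v1 = 0" "v2 \<noteq> 0" | "v1 \<noteq> 0" "v2 = 0" | "v1 \<noteq> 0" "v2 \<noteq> 0"
      using v True by auto
    then show False
    proof cases
      case 1
      \<comment> \<open>The hole (x, 0, z) on a line parallel to the second axis is made up for by
        (x, \<open>f z x\<close>, z) on the same line.\<close>
      from hy[OF 1(2) p0] obtain l where l: "l < p" "y l = 0" by auto
      with y0 have X: "z l \<in> Z" "x l \<in> X (z l)" by auto
      have "f (z l) (x l) < p" using f_in_Y[OF X(2)] pos(3) by blast
      from hy[OF 1(2) this] obtain m where m: "m < p" "y m = f (z l) (x l)" by auto
      have "z m = z l" "x m = x l" using cz[of m] cz[of l] cx[OF 1(1), of m] cx[OF 1(1), of l] by auto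
      with xf[OF m(1)] m X show False by auto
    next
      case 2
      from hx[OF 2(1) p0] obtain l where l: "l < p" "x l = 0" by auto
      with x0 have Y: "z l \<in> Z" "y l \<in> Y (z l)" by auto
      \<comment> \<open>Surjectivity of \<open>f z\<close> supplies an added point with the second
        coordinate of the hole.\<close>
      then obtain c where c: "c \<in> X (z l)" "f (z l) c = y l"
        using bij by (metis bij_betw_imp_surj_on imageE)
      from hx[OF 2(1)] pos(4)[OF c(1)] obtain m where m: "m < p" "x m = c" by auto
      have "z m = z l" "y m = y l" using cz[of m] cz[of l] cy[OF 2(2), of m] cy[OF 2(2), of l] by auto
      with xf[OF m(1)] m Y c show False by auto
    next
      case 3
      from hx[OF 3(1) p0] obtain k where k: "k < p" "x k = 0" by auto
      from hy[OF 3(2) p0] obtain l where l: "l < p" "y l = 0" by auto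
      \<comment> \<open>At first coordinate z the line can meet an added point (z, b, z);
        \<open>planar\<close> puts b into \<open>Q\<close>.\<close>
      from hx[OF 3(1) lt(3)[of 0]] obtain m where m: "m < p" "x m = z 0" by auto
      have Z: "z 0 \<in> Z" and Y: "y k \<in> Y (z 0)" and X: "x l \<in> X (z 0)"
        using x0[OF k] y0[OF l] cz[of k] cz[of l] by auto
      have "[(int (x m) - int (x k)) * (int (y l) - int (y k))
           = (int (x l) - int (x k)) * (int (y m) - int (y k))] (mod int p)"
        unfolding x_def y_def by (rule line_coordinates_proportional)
      then have "[int (z 0) * (- int (y k)) = int (x l) * (int (y m) - int (y k))] (mod int p)"
        using k l m by simp
      then have "[int (y m) * int (x l) = int (y k) * (int (x l) - int (z 0))] (mod int p)"
        by (simp add: cong_iff_dvd_diff algebra_simps dvd_diff_commute)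
      then have "y m \<in> Q"
        using planar[OF Z X _ lt(2)] Y Y_sub by blast
      with xz[OF m(1)] m Z cz[of m] show False by auto
    qed
  next
    case False
    from hz[OF False p0] obtain k where k: "k < p" "z k = 0" by auto
    with z0 have R: "x k \<in> Z" "y k \<in> Q" by auto
    consider "v1 = 0" "v2 = 0" | "v1 = 0" "v2 \<noteq> 0" | "v1 \<noteq> 0" "v2 = 0" | "v1 \<noteq> 0" "v2 \<noteq> 0"
      by auto
    then show False
    proof cases
      case 1
      \<comment> \<open>The vertical line through the hole (a, b, 0) contains the added point (a, b,
        a).\<close>
      from hz[OF False lt(1)[of k]] obtain m where m: "m < p" "z m = x k" by auto
      have "x m = x k" "y m = y k"
        using cx[OF 1(1), of m] cx[OF 1(1), of k] cy[OF 1(2), of m] cy[OF 1(2), of k] by auto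
      with xz[OF m(1)] m R show False by auto
    next
      case 2
      from hy[OF 2(2) p0] obtain l where l: "l < p" "y l = 0" by auto
      \<comment> \<open>The constant first coordinate would lie both in \<open>Z\<close> and in some
        \<open>X z\<close>, which are disjoint.\<close>
      with y0 have "x l \<in> X (z l)" by auto
      moreover have "x l = x k" using cx[OF 2(1), of l] cx[OF 2(1), of k] by auto
      ultimately show False using R pos(5) by auto
    next
      case 3
      from hx[OF 3(1) p0] obtain l where l: "l < p" "x l = 0" by auto
      with x0 have "y l \<in> Y (z l)" by auto
      moreover have "y l = y k" using cy[OF 3(2), of l] cy[OF 3(2), of k] by auto
      ultimately show False using R pos(6) by auto
    next
      case 4
      from hx[OF 4(1) p0] obtain i where i: "i < p" "x i = 0" by auto
      from hy[OF 4(2) p0] obtain j where j: "j < p" "y j = 0" by auto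
      have W: "z i \<in> Z" and Z: "z j \<in> Z" and X: "x j \<in> X (z j)" using x0[OF i] y0[OF j] by auto
      \<comment> \<open>The line passes through a hole in each plane. Forgetting the second
        coordinate gives exactly the relation that \<open>transversal\<close> forbids, if the
        heights differ.\<close>
      have "[(int (x j) - int (x k)) * (int (z i) - int (z k))
           = (int (x i) - int (x k)) * (int (z j) - int (z k))] (mod int p)"
        unfolding x_def z_def by (rule line_coordinates_proportional)
      then have "[(int (x j) - int (x k)) * int (z i) = - int (x k) * int (z j)] (mod int p)"
        using k i by simp
      then have c: "[int (x j) * int (z i) = int (x k) * (int (z i) - int (z j))] (mod int p)"
        by (simp add: cong_iff_dvd_diff algebra_simps)
      show False
      proof (cases "z i = z j")
        case True
        \<comment> \<open>For equal heights the relation makes p divide a product of two numbers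
          strictly between 0 and p.\<close>
        then have "int p dvd int (x j) * int (z i)" using c by (simp add: cong_0_iff)
        then have "p dvd x j * z i" by (metis of_nat_dvd_iff of_nat_mult)
        then have "p dvd x j \<or> p dvd z i" using prime_p by (simp add: prime_dvd_mult_iff)
        then show False using pos(4)[OF X] pos(1)[OF W] by (auto dest: dvd_imp_le)
      next
        case False
        with transversal[OF Z W _ R(1) X] c show False by auto
      qed
    qed
  qed
qed

section \<open>Size of the blocking set\<close>

text \<open>The three planes together have 3p^2 - 3p + 1 points. The points (z, y, z) offset the
  holes in z = 0, and the points (x, \<open>f z x\<close>, z) offset those in x = 0; the holes in y
  = 0 are the net gain.\<close>

lemma card_blocker:
  "int (card blocker) \<le> 3 * int p ^ 2 - 3 * int p + 1 - (\<Sum>z\<in>Z. int (card (X z)))"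
proof -
  have p0: "p > 0" using prime_p by (simp add: prime_gt_0_nat)
  have finZ: "finite Z" using Z_sub finite_subset by blast
  have finQ: "finite Q" using Q_sub finite_subset by blast
  have finX: "finite (X z)" for z using X_sub[of z] by (meson finite_Diff finite_atLeastLessThan finite_subset)
  have finY: "finite (Y z)" for z using bij_betw_finite[OF bij[of z]] finX by auto
  have cXY: "card (Y z) = card (X z)" for z using bij_betw_same_card[OF bij[of z]] by simp
  define s where "s = (\<Sum>z\<in>Z. card (X z))"
  \<comment> \<open>\<open>B1\<close>, \<open>B2\<close>, \<open>B3\<close> assign each point of the
    planes to the first plane containing it, which gives p^2, p(p - 1) and (p - 1)^2 points before
    the holes are taken out.\<close>
  define B1 where "B1 = (\<lambda>(z, y). (0::nat, y, z)) ` ({..<p} \<times> {..<p} - Sigma Z Y)"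
  define B2 where "B2 = (\<lambda>(z, x). (x, 0::nat, z)) ` ({..<p} \<times> {1..<p} - Sigma Z X)"
  define B3 where "B3 = (\<lambda>(x, y). (x, y, 0::nat)) ` ({1..<p} \<times> {1..<p} - Z \<times> Q)"
  define B4 where "B4 = (\<lambda>(z, y). (z, y, z)) ` (Z \<times> Q)"
  define B5 where "B5 = (\<lambda>(z, x). (x, f z x, z)) ` Sigma Z X"
  have fin: "finite (Sigma Z X)" "finite (Sigma Z Y)" "finite (Z \<times> Q)"
    using finZ finX finY finQ by auto
  have sub: "blocker \<subseteq> B1 \<union> (B2 \<union> (B3 \<union> (B4 \<union> B5)))"
  proof
    fix q assume q: "q \<in> blocker"
    obtain x y z where xyz: "q = (x, y, z)" by (metis prod.collapse)
    from q have lt: "x < p" "y < p" "z < p"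
      and c: "x = 0 \<and> \<not> (z \<in> Z \<and> y \<in> Y z) \<or> y = 0 \<and> \<not> (z \<in> Z \<and> x \<in> X z) \<or>
        z = 0 \<and> \<not> (x \<in> Z \<and> y \<in> Q) \<or> z \<in> Z \<and> x = z \<and> y \<in> Q \<or> z \<in> Z \<and> x \<in> X z \<and> y = f z x"
      by (auto simp: blocker_def xyz)
    \<comment> \<open>No hole lies on a second coordinate plane, so looking only at the first plane
      through a point loses nothing.\<close>
    consider "x = 0" "\<not> (z \<in> Z \<and> y \<in> Y z)" | "x \<noteq> 0" "y = 0" "\<not> (z \<in> Z \<and> x \<in> X z)"
      | "x \<noteq> 0" "y \<noteq> 0" "z = 0" "\<not> (x \<in> Z \<and> y \<in> Q)" | "z \<in> Z" "x = z" "y \<in> Q"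
      | "z \<in> Z" "x \<in> X z" "y = f z x"
      using c pos(1)[of z] pos(3)[of 0 z] pos(4)[of 0 z] pos(1)[of 0] pos(2)[of 0] pos(1)[of x] pos(2)[of y]
      by (metis less_irrefl)
    then show "q \<in> B1 \<union> (B2 \<union> (B3 \<union> (B4 \<union> B5)))"
    proof cases
      case 1
      then have "q \<in> B1" using lt unfolding B1_def xyz by (intro image_eqI[of _ _ "(z, y)"]) auto
      then show ?thesis by simp
    next
      case 2
      then have "q \<in> B2" using lt unfolding B2_def xyz by (intro image_eqI[of _ _ "(z, x)"]) auto
      then show ?thesis by simp
    next
      case 3
      then have "q \<in> B3" using lt unfolding B3_def xyz by (intro image_eqI[of _ _ "(x, y)"]) auto
      then show ?thesis by simp
    next
      case 4
      then have "q \<in> B4" using lt unfolding B4_def xyz by (intro image_eqI[of _ _ "(z, y)"]) auto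
      then show ?thesis by simp
    next
      case 5
      then have "q \<in> B5" using lt unfolding B5_def xyz by (intro image_eqI[of _ _ "(z, x)"]) auto
      then show ?thesis by simp
    qed
  qed
  have cS: "card (Sigma Z X) = s" "card (Sigma Z Y) = s"
    using finZ finX finY cXY by (auto simp: s_def)
  have subs: "Sigma Z Y \<subseteq> {..<p} \<times> {..<p}" "Sigma Z X \<subseteq> {..<p} \<times> {1..<p}"
    "Z \<times> Q \<subseteq> {1..<p} \<times> {1..<p}"
    using pos(1) pos(3) pos(4) Z_sub Q_sub X_sub by fastforce+
  have diff: "int (card (U - V)) = int (card U) - int (card V)" if "V \<subseteq> U" "finite U"
    for U V :: "(nat \<times> nat) set"
    using that by (simp add: card_Diff_subset card_mono finite_subset of_nat_diff)
  have "int (card B1) \<le> int (card ({..<p} \<times> {..<p} - Sigma Z Y))"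
    unfolding B1_def by (intro of_nat_mono card_image_le) auto
  also have "\<dots> = int p * int p - int s" using diff[OF subs(1)] cS by simp
  finally have c1: "int (card B1) \<le> int p * int p - int s" .
  have "int (card B2) \<le> int (card ({..<p} \<times> {1..<p} - Sigma Z X))"
    unfolding B2_def by (intro of_nat_mono card_image_le) auto
  also have "\<dots> = int p * (int p - 1) - int s" using diff[OF subs(2)] cS p0 by (simp add: of_nat_diff)
  finally have c2: "int (card B2) \<le> int p * (int p - 1) - int s" .
  have "int (card B3) \<le> int (card ({1..<p} \<times> {1..<p} - Z \<times> Q))"
    unfolding B3_def by (intro of_nat_mono card_image_le) auto
  also have "\<dots> = (int p - 1) * (int p - 1) - int (card (Z \<times> Q))"
    using diff[OF subs(3)] p0 by (simp add: of_nat_diff)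
  finally have c3: "int (card B3) \<le> (int p - 1) * (int p - 1) - int (card (Z \<times> Q))" .
  have c4: "int (card B4) \<le> int (card (Z \<times> Q))"
    unfolding B4_def by (intro of_nat_mono card_image_le fin)
  have c5: "int (card B5) \<le> int s"
    unfolding B5_def cS(1)[symmetric] by (intro of_nat_mono card_image_le fin)
  have "card blocker \<le> card (B1 \<union> (B2 \<union> (B3 \<union> (B4 \<union> B5))))"
    using sub fin by (intro card_mono) (auto simp: B1_def B2_def B3_def B4_def B5_def)
  also have "\<dots> \<le> card B1 + (card B2 + (card B3 + (card B4 + card B5)))"
    by (intro order.trans[OF card_Un_le] add_left_mono order.refl)
  finally have "int (card blocker) \<le> int (card B1) + int (card B2) + int (card B3) + int (card B4) + int (card B5)"
    by linarith
  with c1 c2 c3 c4 c5 have "int (card blocker)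
      \<le> int p * int p + int p * (int p - 1) + (int p - 1) * (int p - 1) - int s"
    by linarith
  then show ?thesis by (simp add: s_def algebra_simps power2_eq_square)
qed

lemma r_p3_ge:
  "int (r_p3 p) \<ge> int p ^ 3 - 3 * int p ^ 2 + 3 * int p - 1 + (\<Sum>z\<in>Z. int (card (X z)))"
proof -
  define S where "S = Fp3 p - blocker"
  have finF: "finite (Fp3 p)" by (simp add: Fp3_def)
  have "\<not> contains_full_line p S"
  proof
    assume "contains_full_line p S"
    then obtain a v where v: "v \<in> Fp3 p" "v \<noteq> (0, 0, 0)" "affine_line p a v \<subseteq> S"
      unfolding contains_full_line_def by blast
    then have "fst v < p" "fst (snd v) < p" "snd (snd v) < p" "(fst v, fst (snd v), snd (snd v)) \<noteq> (0, 0, 0)"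
      by (auto simp: Fp3_def)
    from blocker_meets_line[OF this, of "fst a" "fst (snd a)" "snd (snd a)"] v(3)
    show False by (force simp: affine_line_def S_def)
  qed
  moreover have "S \<subseteq> Fp3 p" by (simp add: S_def)
  moreover have "finite {card S | S. S \<subseteq> Fp3 p \<and> \<not> contains_full_line p S}"
    by (rule finite_subset[of _ "card ` Pow (Fp3 p)"]) (use finF in auto)
  ultimately have "card S \<le> r_p3 p"
    unfolding r_p3_def by (intro Max_ge) auto
  moreover have "blocker \<subseteq> Fp3 p" by (auto simp: blocker_def Fp3_def)
  then have "int (card S) = int (card (Fp3 p)) - int (card blocker)"
    unfolding S_def using finF
    by (simp add: card_Diff_subset card_mono finite_subset of_nat_diff)
  moreover have "int (card (Fp3 p)) = int p ^ 3"
    by (simp add: Fp3_def power3_eq_cube)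
  ultimately show ?thesis using card_blocker by linarith
qed

end

section \<open>Quadratic residues and nonresidues\<close>

text \<open>By Euler's criterion a nonresidue has (p - 1)/2-th power -1. If the product were a
  nonresidue too, then -1 = (-1)(-1) modulo the odd prime p.\<close>

lemma QuadRes_mult_nonresidues:
  fixes p :: nat and a b :: int
  assumes "prime p" "2 < p" "\<not> QuadRes p a" "\<not> QuadRes p b"
  shows "QuadRes p (a * b)"
proof (rule ccontr)
  assume n: "\<not> QuadRes p (a * b)"
  have L: "[Legendre c p = - 1] (mod p)" if "\<not> QuadRes p c" for c :: int
  proof -
    \<comment> \<open>\<open>QuadRes\<close> holds at 0, so a nonresidue is nonzero modulo p and its
      Legendre symbol is -1.\<close>
    have "\<not> [c = 0] (mod p)"
      using that unfolding QuadRes_def by (metis cong_sym power_zero_numeral)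
    then show ?thesis using that by (simp add: Legendre_def)
  qed
  have E: "[c ^ ((p - 1) div 2) = - 1] (mod p)" if "\<not> QuadRes p c" for c :: int
    using euler_criterion[OF assms(1,2), of c] L[OF that] cong_sym cong_trans by blast
  have "[a ^ ((p - 1) div 2) * b ^ ((p - 1) div 2) = (- 1) * (- 1)] (mod p)"
    using assms by (intro cong_mult E)
  then have "[- 1 = (1::int)] (mod p)"
    using E[OF n] by (metis cong_sym cong_trans power_mult_distrib minus_mult_minus mult_1)
  then have "int p dvd 2" by (simp add: cong_iff_dvd_diff)
  then show False using assms(2) zdvd_imp_le by fastforce
qed

lemma QuadRes_cancel_square:
  fixes p :: nat and a x :: int
  assumes "prime p" "\<not> int p dvd x" "QuadRes p (a * x ^ 2)"
  shows "QuadRes p a"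
proof -
  have "coprime x (int p)"
    using assms by (metis coprime_commute prime_imp_coprime prime_nat_int_transfer)
  then obtain k where k: "[x * k = 1] (mod int p)" using cong_solve_coprime_int by auto
  from assms(3) obtain y where y: "[y ^ 2 = a * x ^ 2] (mod int p)" by (auto simp: QuadRes_def)
  have "[y ^ 2 * k ^ 2 = a * x ^ 2 * k ^ 2] (mod int p)" by (intro cong_mult y cong_refl)
  also have "a * x ^ 2 * k ^ 2 = a * (x * k) ^ 2" by (simp add: power_mult_distrib)
  also have "[a * (x * k) ^ 2 = a * 1 ^ 2] (mod int p)" by (intro cong_mult cong_pow k cong_refl)
  finally have "[(y * k) ^ 2 = a] (mod int p)" by (simp add: power_mult_distrib)
  then show ?thesis by (auto simp: QuadRes_def)
qed

lemma QuadRes_cong: "[a = b] (mod p) \<Longrightarrow> QuadRes p a \<Longrightarrow> QuadRes p b"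
  unfolding QuadRes_def using cong_trans by blast

text \<open>As u and p - u have the same square, the nonzero residues are among the squares of 1,
  ..., (p - 1)/2; at least half of the nonzero classes remain.\<close>

lemma card_nonresidues_ge:
  fixes p :: nat
  assumes "prime p" "2 < p"
  shows "(p - 1) div 2 \<le> card {b \<in> {1..<p}. \<not> QuadRes p (int b)}"
proof -
  define Q where "Q = {b \<in> {1..<p}. QuadRes p (int b)}"
  have "odd p" using assms prime_odd_nat by auto
  then obtain h where h: "p = 2 * h + 1" by (elim oddE)
  have "Q \<subseteq> (\<lambda>y. (y ^ 2) mod p) ` {1..h}"
  proof
    fix b assume b: "b \<in> Q"
    then obtain y where y: "[y ^ 2 = int b] (mod int p)" by (auto simp: Q_def QuadRes_def)
    define u where "u = nat (y mod int p)"
    have u: "int u = y mod int p" "u < p" using h by (auto simp: u_def nat_less_iff)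
    have ub: "[int u ^ 2 = int b] (mod int p)"
      unfolding u using y by (metis cong_def power_mod)
    define w where "w = (if u \<le> h then u else p - u)"
    have "[int w ^ 2 = int u ^ 2] (mod int p)"
    proof (cases "u \<le> h")
      case False
      then have "int w ^ 2 - int u ^ 2 = int p * (int p - 2 * int u)"
        using u(2) by (simp add: w_def of_nat_diff power2_eq_square algebra_simps)
      then show ?thesis by (simp add: cong_iff_dvd_diff)
    qed (simp add: w_def)
    then have "[int (w ^ 2) = int b] (mod int p)" using ub cong_trans by force
    then have wb: "[w ^ 2 = b] (mod p)" using cong_int_iff by blast
    then have e: "(w ^ 2) mod p = b" using b by (simp add: cong_def Q_def)
    have "w \<noteq> 0" using e b by (auto simp: Q_def intro: ccontr)
    moreover have "w \<le> h" using u(2) h by (auto simp: w_def)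
    ultimately show "b \<in> (\<lambda>y. (y ^ 2) mod p) ` {1..h}" using e by force
  qed
  then have "card Q \<le> card {1..h}" by (rule surj_card_le[rotated]) simp
  moreover have "{b \<in> {1..<p}. \<not> QuadRes p (int b)} = {1..<p} - Q" by (auto simp: Q_def)
  moreover have "card ({1..<p} - Q) = card {1..<p} - card Q"
    by (rule card_Diff_subset) (auto simp: Q_def)
  ultimately show ?thesis using h by simp
qed

text \<open>The substitution x = z/(1 - n) gives x - z = nx, hence x(x - z) = n x^2. So each
  nonresidue n yields an admissible x, and distinct n yield distinct x.\<close>

lemma card_shifted_nonresidues_ge:
  fixes p z :: nat
  assumes p: "prime p" "2 < p" and z: "0 < z" "z < p"
  shows "(p - 1) div 2 \<le> card {x \<in> {1..<p}. \<not> QuadRes p (int x * (int x - int z))}"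
    (is "_ \<le> card ?G")
proof -
  let ?N = "{b \<in> {1..<p}. \<not> QuadRes p (int b)}"
  have ex: "\<exists>x. x \<in> ?G \<and> [int x * (1 - int n) = int z] (mod int p)" if n: "n \<in> ?N" for n
  proof -
    \<comment> \<open>As 1 is a square, n differs from 1 and 1 - n is invertible.\<close>
    have "QuadRes p 1" by (auto simp: QuadRes_def intro: exI[of _ 1])
    then have "n \<noteq> 1" using n by auto
    then have "\<not> int p dvd 1 - int n"
      using n zdvd_not_zless[of "int n - 1" "int p"] by (auto simp: dvd_diff_commute)
    then have "coprime (1 - int n) (int p)"
      using p by (metis coprime_commute prime_imp_coprime prime_nat_int_transfer)
    then obtain k where k: "[(1 - int n) * k = 1] (mod int p)" using cong_solve_coprime_int by auto
    define x where "x = nat ((k * int z) mod int p)"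
    have x: "int x = (k * int z) mod int p" "x < p" using p by (auto simp: x_def nat_less_iff)
    have "[int x * (1 - int n) = k * int z * (1 - int n)] (mod int p)"
      unfolding x by (intro cong_mult cong_refl) (simp add: cong_def)
    also have "k * int z * (1 - int n) = ((1 - int n) * k) * int z" by (simp add: ac_simps)
    also have "[((1 - int n) * k) * int z = 1 * int z] (mod int p)" by (intro cong_mult k cong_refl)
    finally have xn: "[int x * (1 - int n) = int z] (mod int p)" by simp
    have "x \<noteq> 0"
    proof
      assume "x = 0"
      then have "int p dvd int z" using cong_sym[OF xn] by (simp add: cong_0_iff)
      then show False using z zdvd_not_zless by fastforce
    qed
    have nd: "\<not> int p dvd int x" using \<open>x \<noteq> 0\<close> x(2) zdvd_not_zless by fastforce
    have "[int x * (int x - int z) = int x * (int x - int x * (1 - int n))] (mod int p)"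
      by (intro cong_mult cong_diff cong_refl cong_sym[OF xn])
    then have "[int x * (int x - int z) = int n * int x ^ 2] (mod int p)"
      by (simp add: power2_eq_square algebra_simps)
    then have "\<not> QuadRes p (int x * (int x - int z))"
      using n QuadRes_cong QuadRes_cancel_square[OF p(1) nd, of "int n"] by blast
    then have "x \<in> ?G" using \<open>x \<noteq> 0\<close> x(2) by simp
    then show ?thesis using xn by blast
  qed
  then have "\<forall>n\<in>?N. \<exists>x. x \<in> ?G \<and> [int x * (1 - int n) = int z] (mod int p)" by blast
  then obtain g where g: "\<And>n. n \<in> ?N \<Longrightarrow> g n \<in> ?G \<and> [int (g n) * (1 - int n) = int z] (mod int p)"
    unfolding bchoice_iff by blast
  have "inj_on g ?N"
  proof (rule inj_onI)
    fix m n assume mn: "m \<in> ?N" "n \<in> ?N" "g m = g n"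
    have "[int (g m) * (1 - int m) = int (g m) * (1 - int n)] (mod int p)"
      using g[OF mn(1)] g[OF mn(2)] mn(3) cong_sym cong_trans by metis
    moreover have "\<not> int p dvd int (g m)" using g[OF mn(1)] zdvd_not_zless by fastforce
    then have "coprime (int (g m)) (int p)"
      using p by (metis coprime_commute prime_imp_coprime prime_nat_int_transfer)
    ultimately have "[1 - int m = 1 - int n] (mod int p)" by (simp add: cong_mult_lcancel)
    then have "[int m = int n] (mod int p)"
      by (metis cong_diff cong_refl diff_diff_eq2 add_diff_cancel_left')
    then have "[m = n] (mod p)" by (simp add: cong_int_iff)
    then show "m = n" using mn by (auto simp: cong_def)
  qed
  then have "card ?N \<le> card ?G"
    by (rule card_inj_on_le) (use g in auto)
  then show ?thesis using card_nonresidues_ge[OF p] by linarith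
qed

section \<open>Construction of the layers and choice of their number\<close>

lemma r_p3_ge_layers:
  fixes p t :: nat
  assumes p: "prime p" "2 < p" and t: "t < p"
  shows "int (r_p3 p) \<ge> int p ^ 3 - 3 * int p ^ 2 + 3 * int p - 1
     + int t * (int ((p - 1) div 2) - int t ^ 2)"
proof -
  define Z where "Z = {1..t}"
  define Q where "Q = {b \<in> {1..<p}. QuadRes p (int b)}"
  define N where "N = {b \<in> {1..<p}. \<not> QuadRes p (int b)}"
  define h where "h = (p - 1) div 2"
  define G where "G z = {x \<in> {1..<p}. \<not> QuadRes p (int x * (int x - int z))}" for z
  \<comment> \<open>\<open>D z (w, u)\<close> collects the x excluded by \<open>transversal\<close>;
    there is at most one since w is invertible.\<close>
  define D where "D z = (\<lambda>(w, u). {x \<in> {1..<p}. [int x * int w = int u * (int w - int z)] (mod int p)})" for z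
  define X0 where "X0 z = G z - (Z \<union> (\<Union>q\<in>(Z - {z}) \<times> Z. D z q))" for z
  have finG: "finite (G z)" for z by (simp add: G_def)
  have cD: "card (D z q) \<le> 1" if "q \<in> (Z - {z}) \<times> Z" for z q
  proof -
    obtain w u where q: "q = (w, u)" by (cases q)
    have "0 < w" "w < p" using that t by (auto simp: q Z_def)
    then have "coprime (int w) (int p)"
      using p by (metis coprime_commute coprime_int_iff nat_dvd_not_less prime_imp_coprime)
    then have "x = y" if "x \<in> D z q" "y \<in> D z q" for x y
    proof -
      have "[int x * int w = int y * int w] (mod int p)"
        using that cong_sym cong_trans unfolding D_def q by blast
      then have "[int x = int y] (mod int p)" using \<open>coprime (int w) (int p)\<close> by (simp add: cong_mult_rcancel)
      then have "[x = y] (mod p)" by (simp add: cong_int_iff)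
      then show ?thesis using that by (auto simp: cong_def D_def q)
    qed
    moreover have "finite (D z q)" by (simp add: D_def q)
    ultimately show ?thesis by (metis card_le_Suc0_iff_eq One_nat_def)
  qed
  have cX0: "int h - int t ^ 2 \<le> int (card (X0 z))" if z: "z \<in> Z" for z
  proof -
    let ?U = "\<Union>q\<in>(Z - {z}) \<times> Z. D z q"
    have "card ?U \<le> (\<Sum>q\<in>(Z - {z}) \<times> Z. card (D z q))"
      by (rule card_UN_le) (simp add: Z_def)
    also have "\<dots> \<le> (\<Sum>q\<in>(Z - {z}) \<times> Z. 1)" by (intro sum_mono cD)
    also have "\<dots> = (t - 1) * t" using z by (simp add: Z_def)
    \<comment> \<open>The heights themselves cost t values, and the pairs (w, u) with w different
      from z cost at most (t - 1)t more: t^2 in all.\<close>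
    finally have "card (Z \<union> ?U) \<le> t + (t - 1) * t"
      using card_Un_le[of Z ?U] by (simp add: Z_def)
    also have "\<dots> = t ^ 2" by (cases t) (auto simp: power2_eq_square)
    finally have U: "card (Z \<union> ?U) \<le> t ^ 2" .
    have "finite (Z \<union> ?U)" by (auto simp: Z_def D_def)
    then have "card (G z) - card (Z \<union> ?U) \<le> card (X0 z)"
      unfolding X0_def by (rule diff_card_le_card_Diff)
    moreover have "h \<le> card (G z)"
      unfolding h_def G_def using z t by (intro card_shifted_nonresidues_ge p) (auto simp: Z_def)
    ultimately have "h \<le> card (X0 z) + t ^ 2" using U by linarith
    then show ?thesis by (metis diff_le_eq of_nat_add of_nat_le_iff of_nat_power)
  qed
  have hN: "h \<le> card N" unfolding h_def N_def by (rule card_nonresidues_ge[OF p])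
  \<comment> \<open>The locale asks for these sets and bijections at every index z; only the size
    bound needs z in \<open>Z\<close>.\<close>
  have "\<exists>X Y f. X \<subseteq> X0 z \<and> Y \<subseteq> N \<and> bij_betw f X Y \<and> (z \<in> Z \<longrightarrow> int h - int t ^ 2 \<le> int (card X))"
    for z
  proof -
    \<comment> \<open>The cap at \<open>h\<close> guarantees that \<open>N\<close> has a subset of
      the same size, and it does not spoil the bound h - t^2.\<close>
    define m where "m = min (card (X0 z)) h"
    obtain X where X: "X \<subseteq> X0 z" "card X = m"
      using obtain_subset_with_card_n[of m "X0 z"] unfolding m_def by auto
    have "m \<le> card N" using hN unfolding m_def by linarith
    then obtain Y where Y: "Y \<subseteq> N" "card Y = m"
      using obtain_subset_with_card_n[of m N] by auto
    have "finite X" by (rule finite_subset[OF X(1)]) (simp add: X0_def finG)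
    moreover have "finite Y" by (rule finite_subset[OF Y(1)]) (simp add: N_def)
    ultimately obtain f where "bij_betw f X Y"
      using finite_same_card_bij[of X Y] X(2) Y(2) by auto
    moreover have "z \<in> Z \<longrightarrow> int h - int t ^ 2 \<le> int (card X)"
      using cX0[of z] X(2) by (auto simp: m_def min_def)
    ultimately show ?thesis using X Y by blast
  qed
  then have "\<forall>z. \<exists>X Y f. X \<subseteq> X0 z \<and> Y \<subseteq> N \<and> bij_betw f X Y
    \<and> (z \<in> Z \<longrightarrow> int h - int t ^ 2 \<le> int (card X))" by blast
  then obtain X Y f where XYf: "\<And>z. X z \<subseteq> X0 z" "\<And>z. Y z \<subseteq> N" "\<And>z. bij_betw (f z) (X z) (Y z)"
    "\<And>z. z \<in> Z \<Longrightarrow> int h - int t ^ 2 \<le> int (card (X z))"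
    unfolding choice_iff by blast
  interpret line_blocker p Z Q N X Y f
  proof
    show "\<not> [int x * int w = int u * (int w - int z)] (mod int p)"
      if "z \<in> Z" "w \<in> Z" "w \<noteq> z" "u \<in> Z" "x \<in> X z" for z w u x
    proof -
      have "x \<in> X0 z" using XYf(1) that by blast
      then have "x \<notin> D z (w, u)" "x \<in> G z" using that unfolding X0_def by blast+
      then show ?thesis by (auto simp: D_def G_def)
    qed
    show "b \<in> Q" if h: "z \<in> Z" "x \<in> X z" "y \<in> N" "b < p"
      "[int b * int x = int y * (int x - int z)] (mod int p)" for z x y b
    proof -
      have "x \<in> G z" using XYf(1)[of z] h(2) by (auto simp: X0_def)
      then have x: "0 < x" "x < p" "\<not> QuadRes p (int x * (int x - int z))" by (auto simp: G_def)
      have nd: "\<not> int p dvd int x" using x zdvd_not_zless by fastforce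
      have y: "\<not> QuadRes p (int y)" using h(3) by (simp add: N_def)
      have R: "QuadRes p (int y * (int x * (int x - int z)))"
        using QuadRes_mult_nonresidues[OF p y x(3)] .
      \<comment> \<open>Multiplying by x shows that b x^2 is a product of two nonresidues, so b is a
        residue.\<close>
      have e: "[int y * (int x * (int x - int z)) = int b * int x ^ 2] (mod int p)"
        using cong_mult[OF cong_sym[OF h(5)] cong_refl[of "int x"]]
        by (simp add: power2_eq_square ac_simps)
      \<comment> \<open>\<open>QuadRes\<close> alone would allow b = 0, which \<open>Q\<close>
        excludes.\<close>
      have "b \<noteq> 0"
      proof
        assume "b = 0"
        then have "int p dvd int y * (int x * (int x - int z))" using e by (simp add: cong_0_iff)
        then have "int p dvd int y \<or> int p dvd int x * (int x - int z)"
          using p by (metis prime_dvd_mult_iff prime_nat_int_transfer)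
        moreover have "QuadRes p c" if "int p dvd c" for c
          using that unfolding QuadRes_def by (metis cong_0_iff cong_sym power_zero_numeral)
        ultimately show False using y x(3) by blast
      qed
      moreover have "QuadRes p (int b)"
        using QuadRes_cancel_square[OF p(1) nd] QuadRes_cong[OF e R] by blast
      ultimately show ?thesis using h(4) by (simp add: Q_def)
    qed
    show "X z \<subseteq> {1..<p} - Z" for z using XYf(1)[of z] by (auto simp: X0_def G_def)
  qed (use p t XYf in \<open>auto simp: Z_def Q_def N_def\<close>)
  have "int t * (int h - int t ^ 2) = (\<Sum>z\<in>Z. int h - int t ^ 2)" by (simp add: Z_def)
  also have "\<dots> \<le> (\<Sum>z\<in>Z. int (card (X z)))" by (intro sum_mono XYf(4))
  finally show ?thesis using r_p3_ge unfolding h_def by linarith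
qed

theorem theorem3:
  fixes p :: nat
  assumes "prime p" and "p \<ge> 3"
  shows "real (r_p3 p) \<ge> real p ^ 3 - 3 * real p ^ 2 + (1/8) * real p powr (3/2) - (7/16) * real p"
proof -
  define s where "s = sqrt (real p)"
  \<comment> \<open>t(s^2/2 - t^2) is largest at t = s/sqrt 6, about 0.408 s; 2/5 is a convenient
    fraction nearby.\<close>
  define t where "t = nat \<lfloor>2 * s / 5\<rfloor>"
  have s2: "s ^ 2 = real p" by (simp add: s_def)
  have s1: "s \<ge> 1" using assms(2) by (simp add: s_def)
  have tu: "real t \<le> 2 * s / 5" and tl: "2 * s / 5 - 1 \<le> real t"
    using s1 unfolding t_def by linarith+
  have "s \<le> s ^ 2" using s1 by (simp add: power2_eq_square)
  then have "real t < real p" using tu s1 s2 by linarith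
  then have tp: "t < p" by simp
  have "odd p" using assms prime_odd_nat by auto
  then have half: "real ((p - 1) div 2) = (s ^ 2 - 1) / 2" unfolding s2 by (elim oddE) simp
  have "int (r_p3 p) \<ge> int p ^ 3 - 3 * int p ^ 2 + 3 * int p - 1
     + int t * (int ((p - 1) div 2) - int t ^ 2)"
    using assms by (intro r_p3_ge_layers tp) auto
  then have "real_of_int (int p ^ 3 - 3 * int p ^ 2 + 3 * int p - 1
     + int t * (int ((p - 1) div 2) - int t ^ 2)) \<le> real_of_int (int (r_p3 p))"
    by (simp only: of_int_le_iff)
  then have main: "real (r_p3 p) \<ge> real p ^ 3 - 3 * real p ^ 2 + 3 * s ^ 2 - 1
     + real t * ((s ^ 2 - 1) / 2 - real t ^ 2)"
    unfolding half[symmetric] by (simp add: s2)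
  have powr: "real p powr (3/2) = s ^ 3"
  proof -
    have "s ^ 3 = (real p powr (1/2)) powr 3"
      using assms by (simp add: s_def powr_half_sqrt powr_numeral)
    then show ?thesis by (simp add: powr_powr)
  qed
  have "real t ^ 2 \<le> (2 * s / 5) ^ 2" using tu by (intro power_mono) auto
  \<comment> \<open>17/50 is 1/2 - (2/5)^2.\<close>
  then have "(s ^ 2 - 1) / 2 - real t ^ 2 \<ge> 17 / 50 * s ^ 2 - 1 / 2"
    by (simp add: power_divide power_mult_distrib field_simps)
  then have "real t * ((s ^ 2 - 1) / 2 - real t ^ 2) \<ge> real t * (17 / 50 * s ^ 2 - 1 / 2)"
    by (intro mult_left_mono) auto
  \<comment> \<open>Nonnegativity of this factor allows t to be replaced by 2s/5 - 1, even where
    that is negative.\<close>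
  moreover have "17 / 50 * s ^ 2 - 1 / 2 \<ge> 0" using assms(2) s2 by linarith
  then have "real t * (17 / 50 * s ^ 2 - 1 / 2) \<ge> (2 * s / 5 - 1) * (17 / 50 * s ^ 2 - 1 / 2)"
    using tl by (intro mult_right_mono)
  moreover have "(2 * s / 5 - 1) * (17 / 50 * s ^ 2 - 1 / 2)
      = 17 / 125 * s ^ 3 - 17 / 50 * s ^ 2 - 1 / 5 * s + 1 / 2"
    by (simp add: algebra_simps diff_divide_distrib power2_eq_square power3_eq_cube)
  moreover have "s ^ 3 \<ge> 0" "s ^ 2 \<ge> s" using s1 \<open>s \<le> s ^ 2\<close> by auto
  \<comment> \<open>17/125 exceeds 1/8, and the term 3 s^2 absorbs the lower-order losses because s
    >= 1.\<close>
  ultimately have "3 * s ^ 2 - 1 + real t * ((s ^ 2 - 1) / 2 - real t ^ 2) \<ge> 1 / 8 * s ^ 3 - 7 / 16 * s ^ 2"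
    using s1 by linarith
  then show ?thesis using main unfolding powr s2 by linarith
qed

end
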